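(* For any $\lambda\ge 1$, the deltoid operator $L^{(\lambda)}$ satisfies the $CD\big(\frac{3(\lambda-1)}{4},\,2\lambda\big)$ inequality on the deltoid domain $D$.
   Context: Deltoid domain: let $D\subset\mathbb{R}^2\simeq\mathbb{C}$ be the bounded open domain containing $0$ whose boundary is the deltoid curve $t\mapsto \frac13(2e^{it}+e^{-2it})$. Write $Z=x+iy$, $\bar Z=x-iy$ for the coordinates, $\partial_Z,\partial_{\bar Z}$ for the usual complex derivatives. For a real parameter $\lambda>0$, the deltoid operator is $$L^{(\lambda)}f=(\bar Z-Z^2)\,\partial_Z^2 f+(1-Z\bar Z)\,\partial_Z\partial_{\bar Z}f+(Z-\bar Z^2)\,\partial_{\bar Z}^2f-\lambda\,(Z\partial_Z f+\bar Z\partial_{\bar Z} f),$$ i.e. the diffusion operator with (complex-bilinear) $\Gamma(Z,Z)=\bar Z-Z^2$, $\Gamma(\bar Z,\bar Z)=Z-\bar Z^2$, $\Gamma(Z,\bar Z)=\frac12(1-Z\bar Z)$, $L^{(\lambda)}Z=-\lambda Z$, $L^{(\lambda)}\bar Z=-\lambda\bar Z$. It is elliptic in $D$. Let $\mathcal{A}$ be the set of restrictions to $D$ of real functions that are smooth in a neighborhood of $\overline D$. For the deltoid operator $L=L^{(\lambda)}$, set $\Gamma(f,g)=\frac12\big(L(fg)-fLg-gLf\big)$ and $\Gamma_2(f,f)=\frac12 L\Gamma(f,f)-\Gamma(f,Lf)$. For $\rho\in\mathbb{R}$, $n\in[1,\infty]$, $L$ satisfies $CD(\rho,n)$ if $\Gamma_2(f,f)\ge\rho\,\Gamma(f,f)+\frac1n(Lf)^2$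 on $D$ for all $f\in\mathcal{A}$ (with $\frac1n=0$ if $n=\infty$). *)

theory Defs
  imports "HOL-Analysis.Analysis" "HOL-Library.Complex_Order"
begin

section \<open>The deltoid domain\<close>

definition deltoid_curve :: "complex set" where
  "deltoid_curve = range (\<lambda>t::real. (2 * cis t + cis (- 2 * t)) / 3)"

text \<open>That this is the bounded open domain containing 0 whose boundary is the deltoid curve,
  and the only one, is the lemma \<open>deltoid_domain_unique\<close>.\<close>

definition deltoid_domain :: "complex set" where
  "deltoid_domain = connected_component_set (- deltoid_curve) 0"

text \<open>The polynomial \<open>4 (\<Gamma>(Z, cnj Z)\<^sup>2 - \<Gamma>(Z, Z) \<Gamma>(cnj Z, cnj Z))\<close>; it vanishes exactly on
  the deltoid curve and is positive exactly on the domain.\<close>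

definition deltoid_poly :: "complex \<Rightarrow> real" where
  "deltoid_poly z = (1 - (cmod z)\<^sup>2)\<^sup>2 - 4 * (cmod (cnj z - z\<^sup>2))\<^sup>2"

lemma of_real_deltoid_poly:
  "complex_of_real (deltoid_poly z)
     = (1 - z * cnj z)\<^sup>2 - 4 * (cnj z - z\<^sup>2) * (z - (cnj z)\<^sup>2)"
proof -
  have "complex_of_real ((cmod (cnj z - z\<^sup>2))\<^sup>2) = (cnj z - z\<^sup>2) * (z - (cnj z)\<^sup>2)"
    by (subst complex_norm_square) simp
  moreover have "complex_of_real ((cmod z)\<^sup>2) = z * cnj z"
    by (rule complex_norm_square)
  ultimately show ?thesis
    unfolding deltoid_poly_def by (simp only: of_real_diff of_real_mult of_real_power[of "1 - _"]
        of_real_1 of_real_numeral mult.assoc)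
qed

lemma cmod_eq_1_iff_mult_cnj: "cmod a = 1 \<longleftrightarrow> a * cnj a = 1"
proof -
  have "a * cnj a = 1 \<longleftrightarrow> (cmod a)\<^sup>2 = 1"
    unfolding complex_norm_square[symmetric] by (metis of_real_1 of_real_eq_iff)
  then show ?thesis by (smt (verit) norm_ge_zero power2_eq_1_iff)
qed

lemma deltoid_poly_eq_0_iff: "deltoid_poly z = 0 \<longleftrightarrow> z \<in> deltoid_curve"
proof
  assume "z \<in> deltoid_curve"
  then obtain t :: real where t: "z = (2 * cis t + cis (- 2 * t)) / 3"
    by (auto simp: deltoid_curve_def)
  define a b where "a = cis t" and "b = cis (- t)"
  have ab: "a * b = 1" "cnj a = b" "cnj b = a"
    by (auto simp: a_def b_def cis_mult cis_cnj)
  have z: "3 * z = 2 * a + b\<^sup>2"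
    using t by (simp add: a_def b_def Complex.DeMoivre mult.commute)
  then have "cnj (3 * z) = cnj (2 * a + b\<^sup>2)" by simp
  then have zc: "3 * cnj z = 2 * b + a\<^sup>2" using ab by simp
  have "9 - (3 * z) * (3 * cnj z) = 2 * (2 - a^3 - b^3)"
    unfolding z zc using ab(1) by algebra
  moreover have "3 * (3 * cnj z) - (3 * z)\<^sup>2 = - ((a - b\<^sup>2)\<^sup>2)"
    unfolding z zc using ab(1) by algebra
  moreover have "3 * (3 * z) - (3 * cnj z)\<^sup>2 = - ((b - a\<^sup>2)\<^sup>2)"
    unfolding z zc using ab(1) by algebra
  moreover have prod: "(a - b\<^sup>2) * (b - a\<^sup>2) = 2 - a^3 - b^3"
    using ab(1) by algebra
  moreover have "81 * complex_of_real (deltoid_poly z) = (9 - (3 * z) * (3 * cnj z))\<^sup>2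
      - 4 * (3 * (3 * cnj z) - (3 * z)\<^sup>2) * (3 * (3 * z) - (3 * cnj z)\<^sup>2)"
    unfolding of_real_deltoid_poly by (simp add: power2_eq_square algebra_simps)
  ultimately have "81 * complex_of_real (deltoid_poly z) = (2 * (2 - a^3 - b^3))\<^sup>2
      - 4 * (- ((a - b\<^sup>2)\<^sup>2)) * (- ((b - a\<^sup>2)\<^sup>2))"
    by (simp only:)
  also have "\<dots> = 4 * (2 - a^3 - b^3)\<^sup>2 - 4 * ((a - b\<^sup>2) * (b - a\<^sup>2))\<^sup>2"
    by algebra
  also have "\<dots> = 0" using prod by simp
  finally have "81 * complex_of_real (deltoid_poly z) = 0" .
  then show "deltoid_poly z = 0" by simp
next
  assume P: "deltoid_poly z = 0"
  define c w v s where "c = cnj z" and "w = c - z\<^sup>2" and "v = z - c\<^sup>2" and "s = 1 - z * c"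
  have P': "s\<^sup>2 = 4 * w * v"
    using P of_real_deltoid_poly[of z] by (simp add: c_def w_def v_def s_def)
  have s: "cnj s = s" "cnj w = v" by (simp_all add: c_def w_def v_def s_def)
  have "\<exists>a. cmod a = 1 \<and> 3 * z = 2 * a + (cnj a)\<^sup>2"
  proof (cases "w = 0")
    case True
    then have "s = 0" using P' by simp
    then have "z * cnj z = 1" by (simp add: s_def c_def)
    then have "cmod z = 1"
      by (simp add: cmod_eq_1_iff_mult_cnj)
    moreover have "(cnj z)\<^sup>2 = z" using True s by (auto simp: v_def c_def)
    ultimately show ?thesis by (intro exI[of _ z]) simp
  next
    case False
    then have v0: "v \<noteq> 0" using s by force
    define a where "a = s / (2 * w)"
    have ca: "cnj a = s / (2 * v)" by (simp add: a_def s)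
    have "a * cnj a = 1" using P' False v0
      by (simp add: ca) (simp add: a_def power2_eq_square field_simps)
    then have n: "cmod a = 1"
      by (simp add: cmod_eq_1_iff_mult_cnj)
    have "3 * z * (w * v) - (s * v + w\<^sup>2) = - z * (s\<^sup>2 - 4 * w * v)"
      unfolding w_def v_def s_def by algebra
    then have "3 * z * (w * v) = s * v + w\<^sup>2"
      using P' by simp
    then have 1: "3 * z = s / w + w / v"
      using False v0 by (simp add: field_simps power2_eq_square)
    have 2: "(cnj a)\<^sup>2 = w / v"
      using P' v0 by (simp add: ca field_simps power2_eq_square)
    have "3 * z = 2 * a + (cnj a)\<^sup>2"
      unfolding 2 unfolding 1 by (simp add: a_def)
    with n show ?thesis by blast
  qed
  then obtain a where a: "cmod a = 1" "3 * z = 2 * a + (cnj a)\<^sup>2" by blast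
  then have "a = cis (Arg a)" using cis_Arg[of a] by (cases "a = 0") (auto simp: Complex.sgn_eq)
  then obtain t where "a = cis t" by blast
  with a(2) have "z = (2 * cis t + cis (- 2 * t)) / 3"
    by (simp add: cis_cnj Complex.DeMoivre mult.commute[of z 3])
  then show "z \<in> deltoid_curve" by (auto simp: deltoid_curve_def)
qed

lemma continuous_on_deltoid_poly: "continuous_on S deltoid_poly"
  unfolding deltoid_poly_def by (intro continuous_intros)

lemma deltoid_poly_scaled:
  "deltoid_poly (of_real k * z)
     = 1 - 6 * k\<^sup>2 * (cmod z)\<^sup>2 + 8 * k^3 * Re (z^3) - 3 * k^4 * (cmod z)^4"
proof -
  obtain x y where z: "z = Complex x y" by (cases z)
  have 4: "(cmod z)^4 = (x\<^sup>2 + y\<^sup>2)\<^sup>2"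
    by (simp add: z cmod_def power4_eq_xxxx power2_eq_square)
  have re: "Re (z^3) = x^3 - 3 * x * y\<^sup>2"
    by (simp add: z power3_eq_cube power2_eq_square algebra_simps)
  show ?thesis
    unfolding 4 re unfolding deltoid_poly_def cmod_power2
    by (simp add: z) (simp add: power2_eq_square power3_eq_cube power4_eq_xxxx algebra_simps)
qed

lemma deltoid_poly_radial:
  assumes "0 \<le> k" "k < 1" "z \<noteq> 0"
  shows "deltoid_poly z < deltoid_poly (of_real k * z)"
proof -
  define n c where "n = cmod z" and "c = Re (z^3)"
  have n: "n > 0" using assms by (simp add: n_def)
  have c: "c \<le> n^3" unfolding c_def n_def
    by (metis complex_Re_le_cmod norm_power)
  have k3: "k^3 \<le> 1" using assms by (simp add: power_le_one)
  define A B C where "A = 6 * (1 + k)" and "B = 8 * (1 + k + k\<^sup>2)"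
    and "C = 3 * (1 + k + k\<^sup>2 + k^3)"
  have C: "C > 0" using assms by (simp add: C_def add_pos_nonneg)
  have "B\<^sup>2 - 4 * A * C = - (8 * (1 - k)\<^sup>2 * (1 + 4 * k + k\<^sup>2))"
    unfolding A_def B_def C_def by algebra
  moreover have "(1 - k)\<^sup>2 * (1 + 4 * k + k\<^sup>2) > 0"
    using assms by (intro mult_pos_pos) (auto simp: add_pos_nonneg)
  ultimately have disc: "B\<^sup>2 - 4 * A * C < 0" by linarith
  have "4 * C * (A - B * n + C * n\<^sup>2) = (2 * C * n - B)\<^sup>2 - (B\<^sup>2 - 4 * A * C)"
    by algebra
  then have "4 * C * (A - B * n + C * n\<^sup>2) > 0" using disc by (smt (verit) zero_le_power2)
  then have q: "A - B * n + C * n\<^sup>2 > 0" using C by (simp add: zero_less_mult_iff)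
  have "deltoid_poly (of_real k * z) - deltoid_poly z
      = 6 * n\<^sup>2 * (1 - k\<^sup>2) - 8 * c * (1 - k^3) + 3 * n^4 * (1 - k^4)"
    using deltoid_poly_scaled[of k z] deltoid_poly_scaled[of 1 z]
    by (simp add: n_def c_def algebra_simps)
  also have "\<dots> = n\<^sup>2 * (1 - k) * (A - B * n + C * n\<^sup>2) + 8 * (n^3 - c) * (1 - k^3)"
    unfolding A_def B_def C_def by algebra
  also have "\<dots> > 0"
    using n assms c k3
    by (intro add_pos_nonneg[OF mult_pos_pos[OF mult_pos_pos q]] mult_nonneg_nonneg) auto
  finally show ?thesis by simp
qed

lemma deltoid_poly_0: "deltoid_poly 0 = 1"
  by (simp add: deltoid_poly_def)

lemma deltoid_domain_eq: "deltoid_domain = {z. deltoid_poly z > 0}"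
proof
  let ?S = "{z. deltoid_poly z > 0}"
  have "closed_segment 0 z \<subseteq> ?S" if "z \<in> ?S" for z
  proof
    fix w assume "w \<in> closed_segment 0 z"
    then obtain k where k: "0 \<le> k" "k \<le> 1" "w = of_real k * z"
      by (auto simp: closed_segment_def scaleR_conv_of_real)
    then show "w \<in> ?S"
      using that deltoid_poly_radial[of k z] deltoid_poly_0
      by (cases "k = 1"; cases "z = 0") auto
  qed
  moreover have "0 \<in> ?S" by (simp add: deltoid_poly_0)
  ultimately have "starlike ?S" unfolding starlike_def by blast
  then have conn: "connected ?S" by (rule starlike_imp_connected)
  show "?S \<subseteq> deltoid_domain" unfolding deltoid_domain_def
    using conn by (intro connected_component_maximal)
      (auto simp: deltoid_poly_0 simp flip: deltoid_poly_eq_0_iff)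
  have zero: "0 \<in> deltoid_domain"
    by (simp add: deltoid_domain_def deltoid_poly_0 flip: deltoid_poly_eq_0_iff)
  show "deltoid_domain \<subseteq> ?S"
  proof (intro subsetI CollectI, rule ccontr)
    fix z assume z: "z \<in> deltoid_domain" "\<not> deltoid_poly z > 0"
    have "connected (deltoid_poly ` deltoid_domain)"
      unfolding deltoid_domain_def
      by (intro connected_continuous_image continuous_on_deltoid_poly connected_connected_component)
    then have "0 \<in> deltoid_poly ` deltoid_domain"
      using connectedD_interval[OF _ imageI[OF z(1)] imageI[OF zero]] z(2) deltoid_poly_0
      by (metis not_less zero_le_one)
    then obtain w where "w \<in> deltoid_domain" "w \<in> deltoid_curve"
      unfolding deltoid_poly_eq_0_iff[symmetric] by force
    then show False
      unfolding deltoid_domain_def using connected_component_subset by blast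
  qed
qed

lemma open_deltoid_domain: "open deltoid_domain"
  unfolding deltoid_domain_eq
  by (intro open_Collect_less continuous_on_deltoid_poly continuous_intros)

lemma bounded_deltoid_domain: "bounded deltoid_domain"
proof (rule boundedI[of _ 1], rule ccontr)
  fix z assume "z \<in> deltoid_domain" "\<not> cmod z \<le> 1"
  then have z: "deltoid_poly z > 0" "cmod z > 1" by (auto simp: deltoid_domain_eq)
  define w where "w = of_real (1 / cmod z) * z"
  have "cmod w = 1" using z(2) by (auto simp: w_def norm_mult norm_divide)
  then have "deltoid_poly w \<le> 0" by (simp add: deltoid_poly_def)
  moreover have "z \<noteq> 0" using z(2) by auto
  ultimately show False
    using deltoid_poly_radial[of "1 / cmod z" z] z by (simp add: w_def)
qed

lemma frontier_deltoid_domain: "frontier deltoid_domain = deltoid_curve"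
proof -
  have "closure deltoid_domain \<subseteq> {z. deltoid_poly z \<ge> 0}"
    by (intro closure_minimal closed_Collect_le continuous_on_deltoid_poly continuous_intros)
      (auto simp: deltoid_domain_eq)
  then have "frontier deltoid_domain \<subseteq> deltoid_curve"
    using open_deltoid_domain
    by (auto simp: frontier_def interior_open deltoid_domain_eq simp flip: deltoid_poly_eq_0_iff)
  moreover have "deltoid_curve \<subseteq> closure deltoid_domain"
  proof
    fix z assume "z \<in> deltoid_curve"
    then have z: "deltoid_poly z = 0" by (simp add: deltoid_poly_eq_0_iff)
    then have z0: "z \<noteq> 0" using deltoid_poly_0 by auto
    define X where "X n = complex_of_real (1 - 1 / real (Suc n)) * z" for n
    have "X n \<in> deltoid_domain" for n
      using deltoid_poly_radial[of "1 - 1 / real (Suc n)" z] z z0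
      by (simp add: deltoid_domain_eq X_def field_simps)
    moreover have "X \<longlonglongrightarrow> complex_of_real (1 - 0) * z"
      unfolding X_def
      by (intro tendsto_intros lim_inverse_n' LIMSEQ_Suc[OF lim_inverse_n'])
    ultimately show "z \<in> closure deltoid_domain"
      unfolding closure_sequential by auto
  qed
  moreover have "deltoid_curve \<inter> deltoid_domain = {}"
    by (auto simp: deltoid_domain_eq simp flip: deltoid_poly_eq_0_iff)
  ultimately show ?thesis
    using open_deltoid_domain by (auto simp: frontier_def interior_open)
qed

lemma deltoid_domain_unique:
  "open D \<and> connected D \<and> bounded D \<and> 0 \<in> D \<and> frontier D = deltoid_curve
     \<longleftrightarrow> D = deltoid_domain"
proof
  assume D: "open D \<and> connected D \<and> bounded D \<and> 0 \<in> D \<and> frontier D = deltoid_curve"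
  then have "D \<inter> deltoid_curve = {}"
    by (metis frontier_disjoint_eq inf_commute)
  then have sub: "D \<subseteq> deltoid_domain" unfolding deltoid_domain_def
    using D by (intro connected_component_maximal) auto
  have "deltoid_domain \<subseteq> D"
  proof (rule ccontr)
    assume "\<not> deltoid_domain \<subseteq> D"
    then have "deltoid_domain \<inter> frontier D \<noteq> {}"
      using D sub
      by (intro connected_Int_frontier) (auto simp: deltoid_domain_def)
    then show False
      using D by (auto simp: deltoid_domain_eq simp flip: deltoid_poly_eq_0_iff)
  qed
  with sub show "D = deltoid_domain" by simp
next
  assume "D = deltoid_domain"
  then show "open D \<and> connected D \<and> bounded D \<and> 0 \<in> D \<and> frontier D = deltoid_curve"
    using open_deltoid_domain bounded_deltoid_domain frontier_deltoid_domain
    by (auto simp: deltoid_domain_eq deltoid_poly_0)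
       (auto simp: deltoid_domain_def simp flip: deltoid_domain_eq)
qed


section \<open>Smooth functions\<close>

text \<open>On an open subset of a finite-dimensional space, \<open>Ck_on k\<close> is the class of k times
  continuously differentiable functions.\<close>

fun Ck_on :: "nat \<Rightarrow> ('a::real_normed_vector \<Rightarrow> 'b::real_normed_vector) \<Rightarrow> 'a set \<Rightarrow> bool" where
  "Ck_on 0 f U \<longleftrightarrow> continuous_on U f"
| "Ck_on (Suc k) f U \<longleftrightarrow> (\<forall>x\<in>U. f differentiable at x) \<and>
     (\<forall>v. Ck_on k (\<lambda>x. frechet_derivative f (at x) v) U)"

definition smooth_on :: "('a::real_normed_vector \<Rightarrow> 'b::real_normed_vector) \<Rightarrow> 'a set \<Rightarrow> bool" where
  "smooth_on f U \<longleftrightarrow> (\<forall>k. Ck_on k f U)"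

text \<open>The functions are not literally restricted to the open set \<open>D\<close>: all operators below are
  differential operators, evaluated only at points of \<open>D\<close>.\<close>

definition smooth_near_closure :: "complex set \<Rightarrow> (complex \<Rightarrow> real) set" where
  "smooth_near_closure D = {f. \<exists>U. open U \<and> closure D \<subseteq> U \<and> smooth_on f U}"


section \<open>The deltoid operator and the curvature-dimension inequality\<close>

text \<open>The partial derivatives in \<open>x\<close> and \<open>y\<close> are the real directional derivatives along
  \<open>1\<close> and \<open>\<i>\<close>.\<close>

definition dZ :: "(complex \<Rightarrow> complex) \<Rightarrow> complex \<Rightarrow> complex" where
  "dZ f z = (frechet_derivative f (at z) 1 - \<i> * frechet_derivative f (at z) \<i>) / 2"

definition dZbar :: "(complex \<Rightarrow> complex) \<Rightarrow> complex \<Rightarrow> complex" where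
  "dZbar f z = (frechet_derivative f (at z) 1 + \<i> * frechet_derivative f (at z) \<i>) / 2"

definition deltoid_operator :: "real \<Rightarrow> (complex \<Rightarrow> complex) \<Rightarrow> complex \<Rightarrow> complex" where
  "deltoid_operator lam f z =
     (cnj z - z\<^sup>2) * dZ (dZ f) z
     + (1 - z * cnj z) * dZ (dZbar f) z
     + (z - (cnj z)\<^sup>2) * dZbar (dZbar f) z
     - of_real lam * (z * dZ f z + cnj z * dZbar f z)"

definition carre_du_champ ::
  "((complex \<Rightarrow> complex) \<Rightarrow> complex \<Rightarrow> complex) \<Rightarrow>
   (complex \<Rightarrow> complex) \<Rightarrow> (complex \<Rightarrow> complex) \<Rightarrow> complex \<Rightarrow> complex" where
  "carre_du_champ L f g z = (L (\<lambda>w. f w * g w) z - f z * L g z - g z * L f z) / 2"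

definition Gamma2 ::
  "((complex \<Rightarrow> complex) \<Rightarrow> complex \<Rightarrow> complex) \<Rightarrow>
   (complex \<Rightarrow> complex) \<Rightarrow> complex \<Rightarrow> complex" where
  "Gamma2 L f z = L (carre_du_champ L f f) z / 2 - carre_du_champ L f (L f) z"

text \<open>The operator acts on complex-valued functions, to which the real test functions are
  coerced. The order on \<^typ>\<open>complex\<close> is \<open>u \<le> v \<longleftrightarrow> Re u \<le> Re v \<and> Im u = Im v\<close>, so on real values
  this is the usual inequality. For \<open>n = \<infinity>\<close> the coefficient \<open>1 / n\<close> is 0.\<close>

definition curvature_dimension ::
  "complex set \<Rightarrow> ((complex \<Rightarrow> complex) \<Rightarrow> complex \<Rightarrow> complex) \<Rightarrow> real \<Rightarrow> ereal \<Rightarrow> bool" where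
  "curvature_dimension D L \<rho> n \<longleftrightarrow> 1 \<le> n \<and>
     (\<forall>f \<in> smooth_near_closure D. \<forall>z \<in> D.
        let F = (\<lambda>w. complex_of_real (f w)) in
        of_real \<rho> * carre_du_champ L F F z + of_real (real_of_ereal (1 / n)) * (L F z)\<^sup>2
          \<le> Gamma2 L F z)"

end

theory Submission
  imports Defs
begin

text \<open>
  For \<open>\<lambda> = 1\<close> the operator is the Laplacian of a flat metric, and \<open>L\<^sup>(\<^sup>\<lambda>\<^sup>)\<close> differs from it by the
  drift \<open>- (\<lambda> - 1) E\<close>, where \<open>E = Z \<partial>\<^sub>Z + Z' \<partial>\<^sub>Z\<^sub>'\<close> and \<open>Z'\<close> is the conjugate of \<open>Z\<close>. With
  \<open>\<mu> = \<lambda> - 1\<close>, \<open>t = L\<^sup>(\<^sup>1\<^sup>) f\<close> and \<open>T\<close> the \<open>\<Gamma>\<^sub>2\<close> of the flat Laplacian, completing the square in the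
  trace term gives
  \<open>\<Gamma>\<^sub>2 - (3 \<mu> / 4) \<Gamma> - (L f)\<^sup>2 / (2 \<lambda>) = (T - t\<^sup>2 / 2) + \<mu> (t + E f)\<^sup>2 / (2 \<lambda>) + \<mu> S\<close>.
  Here \<open>T\<close> is the squared norm of the Hessian, so \<open>T \<ge> t\<^sup>2 / 2\<close> by Cauchy--Schwarz in dimension two,
  and \<open>S = (- \<Gamma>(Z,Z) p\<^sup>2 + 2 \<Gamma>(Z,Z') \<bar>p\<bar>\<^sup>2 - \<Gamma>(Z',Z') p'\<^sup>2) / 4\<close> with \<open>p = \<partial>\<^sub>Z f\<close> is nonnegative by
  ellipticity.
\<close>

section \<open>Symmetry of mixed derivatives\<close>

abbreviation dirD :: "'a::real_normed_vector \<Rightarrow> ('a \<Rightarrow> real) \<Rightarrow> 'a \<Rightarrow> real" where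
  "dirD v f \<equiv> \<lambda>x. frechet_derivative f (at x) v"

lemma smooth_onD:
  assumes "smooth_on f U"
  shows smooth_on_differentiable: "x \<in> U \<Longrightarrow> f differentiable at x"
    and smooth_on_frechet_derivative: "smooth_on (\<lambda>x. frechet_derivative f (at x) v) U"
proof -
  have f: "Ck_on (Suc k) f U" for k using assms by (simp add: smooth_on_def)
  from f[of 0] show "x \<in> U \<Longrightarrow> f differentiable at x" by simp
  from f show "smooth_on (\<lambda>x. frechet_derivative f (at x) v) U" by (simp add: smooth_on_def)
qed

lemma smooth_on_continuous_on: "smooth_on f U \<Longrightarrow> continuous_on U f"
  unfolding smooth_on_def by (drule spec[of _ 0]) simp

lemma has_real_derivative_along_line:
  fixes f :: "'a::real_normed_vector \<Rightarrow> real"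
  assumes "f differentiable at (p + s *\<^sub>R u)"
  shows "((\<lambda>s. f (p + s *\<^sub>R u)) has_real_derivative dirD u f (p + s *\<^sub>R u)) (at s)"
proof -
  have f: "(f has_derivative frechet_derivative f (at (p + s *\<^sub>R u))) (at (p + s *\<^sub>R u))"
    using assms frechet_derivative_works by blast
  have "((\<lambda>s. p + s *\<^sub>R u) has_derivative (\<lambda>h. h *\<^sub>R u)) (at s)"
    by (auto intro!: derivative_eq_intros)
  from has_derivative_compose[OF this f]
  have "((\<lambda>s. f (p + s *\<^sub>R u)) has_derivative
      (\<lambda>h. frechet_derivative f (at (p + s *\<^sub>R u)) (h *\<^sub>R u))) (at s)" .
  then show ?thesis
    unfolding has_field_derivative_def
    using linear_cmul[OF linear_frechet_derivative[OF assms]] by (simp add: mult_commute_abs)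
qed

text \<open>The mean value theorem is used twice: along \<open>u\<close> for the increment of
  \<open>f\<close> in direction \<open>v\<close>, then along \<open>v\<close> for
  \<open>dirD u f\<close>. Continuity of the second derivative is not involved, only its existence
  on the parallelogram.\<close>

lemma second_difference_mvt:
  fixes f :: "'a::real_normed_vector \<Rightarrow> real"
  assumes "h > 0" and U: "\<And>s t. 0 \<le> s \<Longrightarrow> s \<le> h \<Longrightarrow> 0 \<le> t \<Longrightarrow> t \<le> h \<Longrightarrow> x + s *\<^sub>R u + t *\<^sub>R v \<in> U"
    and f: "\<And>y. y \<in> U \<Longrightarrow> f differentiable at y"
    and fu: "\<And>y. y \<in> U \<Longrightarrow> dirD u f differentiable at y"
  obtains s t where "0 < s" "s < h" "0 < t" "t < h"
    "f (x + h *\<^sub>R u + h *\<^sub>R v) - f (x + h *\<^sub>R u) - f (x + h *\<^sub>R v) + f x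
       = h\<^sup>2 * dirD v (dirD u f) (x + s *\<^sub>R u + t *\<^sub>R v)"
proof -
  define g where "g s = f ((x + h *\<^sub>R v) + s *\<^sub>R u) - f (x + s *\<^sub>R u)" for s
  define g' where "g' s = dirD u f ((x + h *\<^sub>R v) + s *\<^sub>R u) - dirD u f (x + s *\<^sub>R u)" for s
  have "(g has_real_derivative g' s) (at s)" if "0 \<le> s" "s \<le> h" for s
    unfolding g_def g'_def
    using U[OF that, of h] U[OF that, of 0] \<open>h > 0\<close>
    by (intro DERIV_diff has_real_derivative_along_line f) (auto simp: algebra_simps)
  then obtain s where s: "0 < s" "s < h" "g h - g 0 = (h - 0) * g' s"
    using MVT2[OF \<open>h > 0\<close>, of g g'] by blast
  have "((\<lambda>t. dirD u f ((x + s *\<^sub>R u) + t *\<^sub>R v)) has_real_derivative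
      dirD v (dirD u f) ((x + s *\<^sub>R u) + t *\<^sub>R v)) (at t)" if "0 \<le> t" "t \<le> h" for t
    using U[of s t] that s by (intro has_real_derivative_along_line fu) auto
  from MVT2[OF \<open>h > 0\<close> this] obtain t where t: "0 < t" "t < h"
    "dirD u f ((x + s *\<^sub>R u) + h *\<^sub>R v) - dirD u f ((x + s *\<^sub>R u) + 0 *\<^sub>R v)
       = (h - 0) * dirD v (dirD u f) ((x + s *\<^sub>R u) + t *\<^sub>R v)"
    by blast
  show thesis
  proof (rule that[OF s(1,2) t(1,2)])
    have "f (x + h *\<^sub>R u + h *\<^sub>R v) - f (x + h *\<^sub>R u) - f (x + h *\<^sub>R v) + f x = g h - g 0"
      by (simp add: g_def algebra_simps)
    also have "\<dots> = h * g' s"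
      using s(3) by simp
    also have "g' s = h * dirD v (dirD u f) (x + s *\<^sub>R u + t *\<^sub>R v)"
      using t(3) by (simp add: g'_def algebra_simps)
    finally show "f (x + h *\<^sub>R u + h *\<^sub>R v) - f (x + h *\<^sub>R u) - f (x + h *\<^sub>R v) + f x
       = h\<^sup>2 * dirD v (dirD u f) (x + s *\<^sub>R u + t *\<^sub>R v)"
      by (simp add: power2_eq_square)
  qed
qed

text \<open>Schwarz's theorem. The second difference is symmetric in \<open>u\<close> and
  \<open>v\<close>, so on a small parallelogram both mixed derivatives attain the same value, though
  at different points. By continuity these values lie within half of the supposed gap of
  \<open>?a x\<close> and \<open>?b x\<close>, which is a contradiction.\<close>

lemma mixed_directional_derivatives_eq:
  fixes f :: "'a::real_normed_vector \<Rightarrow> real"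
  assumes f: "smooth_on f U" and U: "open U" "x \<in> U"
  shows "dirD v (dirD u f) x = dirD u (dirD v f) x"
proof (rule ccontr)
  let ?a = "dirD v (dirD u f)" and ?b = "dirD u (dirD v f)"
  assume "?a x \<noteq> ?b x"
  define e where "e = dist (?a x) (?b x) / 2"
  have e: "e > 0" using \<open>?a x \<noteq> ?b x\<close> by (simp add: e_def)
  have "isCont ?a x" "isCont ?b x"
    using smooth_on_continuous_on[OF smooth_on_frechet_derivative[OF smooth_on_frechet_derivative[OF f]]] U
    by (simp_all add: continuous_on_eq_continuous_at)
  then obtain d1 d2 where d: "d1 > 0" "d2 > 0"
    "\<And>y. dist y x < d1 \<Longrightarrow> dist (?a y) (?a x) < e" "\<And>y. dist y x < d2 \<Longrightarrow> dist (?b y) (?b x) < e"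
    unfolding continuous_at_eps_delta using e by metis
  obtain d3 where d3: "d3 > 0" "\<And>y. dist y x < d3 \<Longrightarrow> y \<in> U"
    using U open_dist by metis
  define d where "d = min d1 (min d2 d3)"
  \<comment> \<open>The summand 1 keeps \<open>K\<close> positive when \<open>u\<close> and
    \<open>v\<close> vanish; with this \<open>h\<close> the parallelogram stays within distance
    \<open>d\<close> of \<open>x\<close>.\<close>
  define K where "K = norm u + norm v + 1"
  define h where "h = d / K / 2"
  have "d > 0" using d d3 by (simp add: d_def)
  have n: "K > 0" by (simp add: K_def add_nonneg_pos)
  then have h: "h > 0" using \<open>d > 0\<close> by (simp add: h_def)
  have near: "dist (x + s *\<^sub>R u + t *\<^sub>R v) x < d" if "0 \<le> s" "s \<le> h" "0 \<le> t" "t \<le> h" for s t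
  proof -
    have "dist (x + s *\<^sub>R u + t *\<^sub>R v) x \<le> s * norm u + t * norm v"
      using that norm_triangle_ineq[of "s *\<^sub>R u" "t *\<^sub>R v"] by (simp add: dist_norm)
    also have "\<dots> \<le> h * norm u + h * norm v"
      using that by (intro add_mono mult_right_mono) auto
    also have "\<dots> < h * K * 2"
      using mult_pos_pos[OF h n] h by (simp add: K_def algebra_simps)
    also have "\<dots> = d" using n by (simp add: h_def)
    finally show ?thesis .
  qed
  have in_U: "x + s *\<^sub>R u + t *\<^sub>R v \<in> U" if "0 \<le> s" "s \<le> h" "0 \<le> t" "t \<le> h" for s t
    using near[OF that] d3 by (simp add: d_def)
  then have in_U': "x + t *\<^sub>R v + s *\<^sub>R u \<in> U" if "0 \<le> t" "t \<le> h" "0 \<le> s" "s \<le> h" for s t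
    using that by (simp add: add.commute add.left_commute)
  have diff: "f differentiable at y" "dirD w f differentiable at y" if "y \<in> U" for y w
    using f that by (auto intro: smooth_on_differentiable smooth_on_frechet_derivative)
  obtain s t where st: "0 < s" "s < h" "0 < t" "t < h"
    "f (x + h *\<^sub>R u + h *\<^sub>R v) - f (x + h *\<^sub>R u) - f (x + h *\<^sub>R v) + f x
       = h\<^sup>2 * ?a (x + s *\<^sub>R u + t *\<^sub>R v)"
    using second_difference_mvt[OF h, of x u v U f] in_U diff by blast
  obtain t' s' where st': "0 < t'" "t' < h" "0 < s'" "s' < h"
    "f (x + h *\<^sub>R v + h *\<^sub>R u) - f (x + h *\<^sub>R v) - f (x + h *\<^sub>R u) + f x
       = h\<^sup>2 * ?b (x + t' *\<^sub>R v + s' *\<^sub>R u)"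
    using second_difference_mvt[OF h, of x v u U f] in_U' diff by blast
  have "h\<^sup>2 * ?a (x + s *\<^sub>R u + t *\<^sub>R v) = h\<^sup>2 * ?b (x + s' *\<^sub>R u + t' *\<^sub>R v)"
    using st(5) st'(5) by (simp add: algebra_simps)
  then have eq: "?a (x + s *\<^sub>R u + t *\<^sub>R v) = ?b (x + s' *\<^sub>R u + t' *\<^sub>R v)"
    using h by simp
  have "dist (?a (x + s *\<^sub>R u + t *\<^sub>R v)) (?a x) < e"
    using near[of s t] st by (intro d) (simp add: d_def)
  moreover have "dist (?b (x + s' *\<^sub>R u + t' *\<^sub>R v)) (?b x) < e"
    using near[of s' t'] st' by (intro d) (simp add: d_def)
  ultimately show False
    using dist_triangle_half_r[of "?a (x + s *\<^sub>R u + t *\<^sub>R v)" "?a x" "2 * e" "?b x"] eq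
    by (simp add: e_def)
qed

section \<open>Wirtinger derivatives\<close>

text \<open>Every real-linear map of the complex plane has a unique form
  \<open>a * h + b * cnj h\<close>. Stating the derivative this way includes differentiability,
  which the values of \<open>dZ\<close> and \<open>dZbar\<close> alone do not express.\<close>

definition has_wirtinger :: "(complex \<Rightarrow> complex) \<Rightarrow> complex \<Rightarrow> complex \<Rightarrow> complex \<Rightarrow> bool" where
  "has_wirtinger g a b z \<longleftrightarrow> (g has_derivative (\<lambda>h. a * h + b * cnj h)) (at z)"

lemma has_wirtinger_imp_eq:
  assumes "has_wirtinger g a b z"
  shows "dZ g z = a" "dZbar g z = b"
proof -
  have "frechet_derivative g (at z) = (\<lambda>h. a * h + b * cnj h)"
    using frechet_derivative_at assms unfolding has_wirtinger_def by metis
  then show "dZ g z = a" "dZbar g z = b"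
    by (simp_all add: dZ_def dZbar_def algebra_simps)
qed

lemma has_wirtinger_const: "has_wirtinger (\<lambda>_. c) 0 0 z"
  by (simp add: has_wirtinger_def)

lemma has_wirtinger_ident: "has_wirtinger (\<lambda>z. z) 1 0 z"
  by (simp add: has_wirtinger_def)

lemma has_wirtinger_add:
  "has_wirtinger f a b z \<Longrightarrow> has_wirtinger g c d z \<Longrightarrow>
    has_wirtinger (\<lambda>w. f w + g w) (a + c) (b + d) z"
  unfolding has_wirtinger_def by (auto intro!: derivative_eq_intros simp: algebra_simps)

lemma has_wirtinger_mult:
  "has_wirtinger f a b z \<Longrightarrow> has_wirtinger g c d z \<Longrightarrow>
    has_wirtinger (\<lambda>w. f w * g w) (a * g z + f z * c) (b * g z + f z * d) z"
  unfolding has_wirtinger_def by (auto intro!: derivative_eq_intros simp: algebra_simps)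

lemma has_wirtinger_cnj:
  assumes "has_wirtinger f a b z"
  shows "has_wirtinger (\<lambda>w. cnj (f w)) (cnj b) (cnj a) z"
proof -
  have "((\<lambda>w. cnj (f w)) has_derivative (\<lambda>h. cnj (a * h + b * cnj h))) (at z)"
    using assms unfolding has_wirtinger_def by (rule has_derivative_cnj)
  then show ?thesis
    by (simp add: has_wirtinger_def add.commute)
qed

lemma has_wirtinger_transform:
  assumes "has_wirtinger f a b z" "open U" "z \<in> U" "\<And>w. w \<in> U \<Longrightarrow> f w = g w"
  shows "has_wirtinger g a b z"
  using assms has_derivative_transform_within_open[of f _ z UNIV U g] unfolding has_wirtinger_def by blast

text \<open>For real \<open>g\<close>, the functions \<open>wgrad\<close>, \<open>whess\<close> and \<open>wlap\<close> are \<open>\<partial>\<^sub>Z g\<close>, \<open>\<partial>\<^sub>Z\<^sup>2 g\<close> and the mixed derivative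
  \<open>\<partial>\<^sub>Z \<partial>\<^sub>Z\<^sub>' g\<close>; the remaining derivatives of order at most two are their conjugates.\<close>

definition wgrad :: "(complex \<Rightarrow> real) \<Rightarrow> complex \<Rightarrow> complex" where
  "wgrad g z = (of_real (dirD 1 g z) - \<i> * of_real (dirD \<i> g z)) / 2"

lemma has_wirtinger_of_real:
  assumes "g differentiable at z"
  shows "has_wirtinger (\<lambda>w. of_real (g w)) (wgrad g z) (cnj (wgrad g z)) z"
proof -
  let ?D = "frechet_derivative g (at z)"
  have "(g has_derivative ?D) (at z)" using assms frechet_derivative_works by blast
  then have "((\<lambda>w. complex_of_real (g w)) has_derivative (\<lambda>h. of_real (?D h))) (at z)"
    by (rule has_derivative_of_real)
  moreover have "of_real (?D h) = wgrad g z * h + cnj (wgrad g z) * cnj h" for h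
  proof -
    have "?D (Re h *\<^sub>R 1 + Im h *\<^sub>R \<i>) = Re h * ?D 1 + Im h * ?D \<i>"
      using linear_frechet_derivative[OF assms] by (simp add: linear_add linear_cmul)
    moreover have "Re h *\<^sub>R 1 + Im h *\<^sub>R \<i> = h" by (simp add: complex_eq_iff)
    ultimately have "?D h = Re h * ?D 1 + Im h * ?D \<i>" by simp
    then show ?thesis by (simp add: wgrad_def complex_eq_iff field_simps)
  qed
  ultimately show ?thesis by (simp add: has_wirtinger_def)
qed

text \<open>Both \<open>\<partial>\<^sub>Z\<^sub>' g1\<close> and \<open>\<partial>\<^sub>Z g2\<close> are \<open>g12\<close>, so that the symmetry of the mixed derivative is part
  of the definition.\<close>

definition wirtinger2 ::
  "complex set \<Rightarrow> (complex \<Rightarrow> complex) \<Rightarrow> (complex \<Rightarrow> complex) \<Rightarrow> (complex \<Rightarrow> complex) \<Rightarrow>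
    (complex \<Rightarrow> complex) \<Rightarrow> (complex \<Rightarrow> complex) \<Rightarrow> (complex \<Rightarrow> complex) \<Rightarrow> bool" where
  "wirtinger2 U g g1 g2 g11 g12 g22 \<longleftrightarrow> open U \<and> (\<forall>z\<in>U. has_wirtinger g (g1 z) (g2 z) z
      \<and> has_wirtinger g1 (g11 z) (g12 z) z \<and> has_wirtinger g2 (g12 z) (g22 z) z)"

section \<open>Algebra of Wirtinger derivatives of order two\<close>

lemma wirtinger2_const: "open U \<Longrightarrow> wirtinger2 U (\<lambda>_. c) (\<lambda>_. 0) (\<lambda>_. 0) (\<lambda>_. 0) (\<lambda>_. 0) (\<lambda>_. 0)"
  by (simp add: wirtinger2_def has_wirtinger_const)

lemma wirtinger2_ident: "open U \<Longrightarrow> wirtinger2 U (\<lambda>z. z) (\<lambda>_. 1) (\<lambda>_. 0) (\<lambda>_. 0) (\<lambda>_. 0) (\<lambda>_. 0)"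
  by (simp add: wirtinger2_def has_wirtinger_const has_wirtinger_ident)

lemma wirtinger2_cnj:
  assumes "wirtinger2 U g g1 g2 g11 g12 g22"
  shows "wirtinger2 U (\<lambda>z. cnj (g z)) (\<lambda>z. cnj (g2 z)) (\<lambda>z. cnj (g1 z))
    (\<lambda>z. cnj (g22 z)) (\<lambda>z. cnj (g12 z)) (\<lambda>z. cnj (g11 z))"
  using assms unfolding wirtinger2_def by (blast intro: has_wirtinger_cnj)

lemma wirtinger2_add:
  assumes "wirtinger2 U g g1 g2 g11 g12 g22" "wirtinger2 U h h1 h2 h11 h12 h22"
  shows "wirtinger2 U (\<lambda>z. g z + h z) (\<lambda>z. g1 z + h1 z) (\<lambda>z. g2 z + h2 z)
    (\<lambda>z. g11 z + h11 z) (\<lambda>z. g12 z + h12 z) (\<lambda>z. g22 z + h22 z)"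
  using assms unfolding wirtinger2_def by (blast intro: has_wirtinger_add)

lemma wirtinger2_mult:
  assumes "wirtinger2 U g g1 g2 g11 g12 g22" "wirtinger2 U h h1 h2 h11 h12 h22"
  shows "wirtinger2 U (\<lambda>z. g z * h z)
    (\<lambda>z. g1 z * h z + g z * h1 z) (\<lambda>z. g2 z * h z + g z * h2 z)
    (\<lambda>z. g11 z * h z + 2 * (g1 z * h1 z) + g z * h11 z)
    (\<lambda>z. g12 z * h z + g1 z * h2 z + g2 z * h1 z + g z * h12 z)
    (\<lambda>z. g22 z * h z + 2 * (g2 z * h2 z) + g z * h22 z)"
  unfolding wirtinger2_def
proof (intro conjI ballI)
  show "open U" using assms by (simp add: wirtinger2_def)
  fix z assume z: "z \<in> U"
  have *: "has_wirtinger g (g1 z) (g2 z) z" "has_wirtinger h (h1 z) (h2 z) z"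
    "has_wirtinger g1 (g11 z) (g12 z) z" "has_wirtinger h1 (h11 z) (h12 z) z"
    "has_wirtinger g2 (g12 z) (g22 z) z" "has_wirtinger h2 (h12 z) (h22 z) z"
    using assms z by (auto simp: wirtinger2_def)
  show "has_wirtinger (\<lambda>z. g z * h z) (g1 z * h z + g z * h1 z) (g2 z * h z + g z * h2 z) z"
    by (intro has_wirtinger_mult *)
  show "has_wirtinger (\<lambda>z. g1 z * h z + g z * h1 z)
      (g11 z * h z + 2 * (g1 z * h1 z) + g z * h11 z)
      (g12 z * h z + g1 z * h2 z + g2 z * h1 z + g z * h12 z) z"
    using has_wirtinger_add[OF has_wirtinger_mult[OF *(3,2)] has_wirtinger_mult[OF *(1,4)]]
    by (simp add: algebra_simps)
  show "has_wirtinger (\<lambda>z. g2 z * h z + g z * h2 z)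
      (g12 z * h z + g1 z * h2 z + g2 z * h1 z + g z * h12 z)
      (g22 z * h z + 2 * (g2 z * h2 z) + g z * h22 z) z"
    using has_wirtinger_add[OF has_wirtinger_mult[OF *(5,2)] has_wirtinger_mult[OF *(1,6)]]
    by (simp add: algebra_simps)
qed

lemma wirtinger2_cong:
  assumes "wirtinger2 U g g1 g2 g11 g12 g22"
    and "\<And>z. z \<in> U \<Longrightarrow> g z = h z" "\<And>z. z \<in> U \<Longrightarrow> g1 z = h1 z" "\<And>z. z \<in> U \<Longrightarrow> g2 z = h2 z"
    and "\<And>z. z \<in> U \<Longrightarrow> g11 z = h11 z" "\<And>z. z \<in> U \<Longrightarrow> g12 z = h12 z" "\<And>z. z \<in> U \<Longrightarrow> g22 z = h22 z"
  shows "wirtinger2 U h h1 h2 h11 h12 h22"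
proof -
  have U: "open U" using assms(1) by (simp add: wirtinger2_def)
  have "has_wirtinger h (h1 z) (h2 z) z \<and> has_wirtinger h1 (h11 z) (h12 z) z
      \<and> has_wirtinger h2 (h12 z) (h22 z) z" if "z \<in> U" for z
    using assms(1) that has_wirtinger_transform[OF _ U that, of g _ _ h]
      has_wirtinger_transform[OF _ U that, of g1 _ _ h1]
      has_wirtinger_transform[OF _ U that, of g2 _ _ h2] assms(2-)
    by (auto simp: wirtinger2_def)
  with U show ?thesis by (simp add: wirtinger2_def)
qed

lemma wirtinger2_transform:
  assumes "wirtinger2 U g g1 g2 g11 g12 g22" "\<forall>z\<in>U. g z = h z"
  shows "wirtinger2 U h g1 g2 g11 g12 g22"
  using assms(1) by (rule wirtinger2_cong) (use assms(2) in auto)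

text \<open>Iterating \<open>dZ\<close> and \<open>dZbar\<close> requires first derivatives as
  functions near \<open>z\<close>. On the open set \<open>U\<close> they coincide with
  \<open>g1\<close> and \<open>g2\<close>, so the derivatives of the latter carry over.\<close>

lemma wirtinger2_imp_eq:
  assumes "wirtinger2 U g g1 g2 g11 g12 g22" "z \<in> U"
  shows "dZ g z = g1 z" "dZbar g z = g2 z" "dZ (dZ g) z = g11 z" "dZ (dZbar g) z = g12 z"
    "dZbar (dZ g) z = g12 z" "dZbar (dZbar g) z = g22 z"
proof -
  have U: "open U" using assms by (simp add: wirtinger2_def)
  have 1: "g1 w = dZ g w" "g2 w = dZbar g w" if "w \<in> U" for w
    using assms(1) that has_wirtinger_imp_eq by (auto simp: wirtinger2_def)
  have "has_wirtinger (dZ g) (g11 z) (g12 z) z" "has_wirtinger (dZbar g) (g12 z) (g22 z) z"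
    using assms has_wirtinger_transform[OF _ U assms(2)] 1 by (auto simp: wirtinger2_def)
  then show "dZ g z = g1 z" "dZbar g z = g2 z" "dZ (dZ g) z = g11 z" "dZ (dZbar g) z = g12 z"
    "dZbar (dZ g) z = g12 z" "dZbar (dZbar g) z = g22 z"
    using 1 assms(2) by (auto simp: has_wirtinger_imp_eq)
qed

section \<open>The operator and its carre du champ in Wirtinger derivatives\<close>

lemma deltoid_operator_wirtinger2:
  assumes "wirtinger2 U g g1 g2 g11 g12 g22" "z \<in> U"
  shows "deltoid_operator lam g z = (cnj z - z\<^sup>2) * g11 z + (1 - z * cnj z) * g12 z
    + (z - (cnj z)\<^sup>2) * g22 z - of_real lam * (z * g1 z + cnj z * g2 z)"
  unfolding deltoid_operator_def using wirtinger2_imp_eq[OF assms] by simp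

text \<open>The drift is a derivation and cancels, which removes \<open>lam\<close>; of the
  second-order part only the cross terms of the product rule survive.\<close>

lemma carre_du_champ_deltoid_operator:
  assumes "wirtinger2 U g g1 g2 g11 g12 g22" "wirtinger2 U h h1 h2 h11 h12 h22" "z \<in> U"
  shows "carre_du_champ (deltoid_operator lam) g h z = (cnj z - z\<^sup>2) * (g1 z * h1 z)
    + (1 - z * cnj z) / 2 * (g1 z * h2 z + g2 z * h1 z) + (z - (cnj z)\<^sup>2) * (g2 z * h2 z)"
  unfolding carre_du_champ_def deltoid_operator_wirtinger2[OF assms(1,3)]
    deltoid_operator_wirtinger2[OF assms(2,3)]
    deltoid_operator_wirtinger2[OF wirtinger2_mult[OF assms(1,2)] assms(3)]
  by (simp add: field_simps)

text \<open>Hides the derivatives, for functions where existence is established first and the values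
  are identified later by uniqueness.\<close>

definition twice_wirtinger :: "complex set \<Rightarrow> (complex \<Rightarrow> complex) \<Rightarrow> bool" where
  "twice_wirtinger U g \<longleftrightarrow> (\<exists>g1 g2 g11 g12 g22. wirtinger2 U g g1 g2 g11 g12 g22)"

lemma twice_wirtinger_const: "open U \<Longrightarrow> twice_wirtinger U (\<lambda>_. c)"
  unfolding twice_wirtinger_def by (intro exI, erule wirtinger2_const)

lemma twice_wirtinger_ident: "open U \<Longrightarrow> twice_wirtinger U (\<lambda>z. z)"
  unfolding twice_wirtinger_def by (intro exI, erule wirtinger2_ident)

lemma twice_wirtinger_cnj: "twice_wirtinger U g \<Longrightarrow> twice_wirtinger U (\<lambda>z. cnj (g z))"
  unfolding twice_wirtinger_def by (elim exE, intro exI, erule wirtinger2_cnj)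

lemma twice_wirtinger_add: "twice_wirtinger U g \<Longrightarrow> twice_wirtinger U h \<Longrightarrow> twice_wirtinger U (\<lambda>z. g z + h z)"
  unfolding twice_wirtinger_def by (elim exE, intro exI, erule (1) wirtinger2_add)

lemma twice_wirtinger_mult: "twice_wirtinger U g \<Longrightarrow> twice_wirtinger U h \<Longrightarrow> twice_wirtinger U (\<lambda>z. g z * h z)"
  unfolding twice_wirtinger_def by (elim exE, intro exI, erule (1) wirtinger2_mult)

lemmas twice_wirtinger_intros = twice_wirtinger_const twice_wirtinger_ident twice_wirtinger_cnj twice_wirtinger_add twice_wirtinger_mult

lemma twice_wirtinger_diff: "twice_wirtinger U g \<Longrightarrow> twice_wirtinger U h \<Longrightarrow> twice_wirtinger U (\<lambda>z. g z - h z)"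
proof -
  assume a: "twice_wirtinger U g" "twice_wirtinger U h"
  then have "open U" by (auto simp: twice_wirtinger_def wirtinger2_def)
  then have "twice_wirtinger U (\<lambda>z. g z + (- 1) * h z)" using a by (intro twice_wirtinger_intros)
  then show ?thesis by simp
qed

section \<open>Second Wirtinger derivatives of real functions\<close>

definition whess :: "(complex \<Rightarrow> real) \<Rightarrow> complex \<Rightarrow> complex" where
  "whess g z = (of_real (dirD 1 (dirD 1 g) z) - of_real (dirD \<i> (dirD \<i> g) z)
      - 2 * \<i> * of_real (dirD 1 (dirD \<i> g) z)) / 4"

definition wlap :: "(complex \<Rightarrow> real) \<Rightarrow> complex \<Rightarrow> complex" where
  "wlap g z = (of_real (dirD 1 (dirD 1 g) z) + of_real (dirD \<i> (dirD \<i> g) z)) / 4"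

text \<open>Symmetry of the mixed derivatives enters here: it merges the two mixed terms in
  \<open>whess\<close> and cancels the imaginary part of the other derivative, leaving the
  real-valued \<open>wlap\<close>.\<close>

lemma has_wirtinger_wgrad:
  assumes g: "smooth_on g U" and U: "open U" "z \<in> U"
  shows "has_wirtinger (wgrad g) (whess g z) (wlap g z) z"
proof -
  have d: "dirD v g differentiable at z" for v
    using smooth_on_differentiable[OF smooth_on_frechet_derivative[OF g] U(2)] .
  have m: "dirD \<i> (dirD 1 g) z = dirD 1 (dirD \<i> g) z"
    using mixed_directional_derivatives_eq[OF g U] .
  have "has_wirtinger (\<lambda>w. (1/2) * of_real (dirD 1 g w) + (- \<i> / 2) * of_real (dirD \<i> g w))
    (0 * of_real (dirD 1 g z) + (1/2) * wgrad (dirD 1 g) z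
      + (0 * of_real (dirD \<i> g z) + (- \<i> / 2) * wgrad (dirD \<i> g) z))
    (0 * of_real (dirD 1 g z) + (1/2) * cnj (wgrad (dirD 1 g) z)
      + (0 * of_real (dirD \<i> g z) + (- \<i> / 2) * cnj (wgrad (dirD \<i> g) z))) z"
    by (intro has_wirtinger_add has_wirtinger_mult has_wirtinger_const has_wirtinger_of_real d)
  moreover have "(\<lambda>w. (1/2) * of_real (dirD 1 g w) + (- \<i> / 2) * of_real (dirD \<i> g w)) = wgrad g"
    by (rule ext) (simp add: wgrad_def field_simps)
  moreover have "0 * of_real (dirD 1 g z) + (1/2) * wgrad (dirD 1 g) z
      + (0 * of_real (dirD \<i> g z) + (- \<i> / 2) * wgrad (dirD \<i> g) z) = whess g z"
    using m by (simp add: wgrad_def whess_def field_simps)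
  moreover have "0 * of_real (dirD 1 g z) + (1/2) * cnj (wgrad (dirD 1 g) z)
      + (0 * of_real (dirD \<i> g z) + (- \<i> / 2) * cnj (wgrad (dirD \<i> g) z)) = wlap g z"
    using m by (simp add: wgrad_def wlap_def field_simps)
  ultimately show ?thesis
    by (simp only:)
qed

lemma wirtinger2_of_real:
  assumes g: "smooth_on g U" and U: "open U"
  shows "wirtinger2 U (\<lambda>w. of_real (g w)) (wgrad g) (\<lambda>w. cnj (wgrad g w))
    (whess g) (wlap g) (\<lambda>w. cnj (whess g w))"
proof -
  have "has_wirtinger (\<lambda>w. cnj (wgrad g w)) (wlap g z) (cnj (whess g z)) z" if "z \<in> U" for z
    using has_wirtinger_cnj[OF has_wirtinger_wgrad[OF g U that]] by (simp add: wlap_def)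
  then show ?thesis
    unfolding wirtinger2_def
    using has_wirtinger_of_real[OF smooth_on_differentiable[OF g]] has_wirtinger_wgrad[OF g U] U
    by simp
qed

lemma twice_wirtinger_of_real: "smooth_on g U \<Longrightarrow> open U \<Longrightarrow> twice_wirtinger U (\<lambda>w. of_real (g w))"
  unfolding twice_wirtinger_def by (intro exI, erule (1) wirtinger2_of_real)

text \<open>All three are combinations, with constant coefficients, of directional derivatives of
  \<open>g\<close>, which are again smooth.\<close>

lemma twice_wirtinger_wgrad_whess_wlap:
  assumes g: "smooth_on g U" and U: "open U"
  shows "twice_wirtinger U (wgrad g)" "twice_wirtinger U (whess g)" "twice_wirtinger U (wlap g)"
  unfolding wgrad_def[abs_def] whess_def[abs_def] wlap_def[abs_def] divide_inverse
  by (intro twice_wirtinger_intros twice_wirtinger_diff twice_wirtinger_of_real smooth_on_frechet_derivative g U)+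

section \<open>The Bochner formula for the deltoid operator\<close>

text \<open>Names the third derivatives of \<open>f\<close>. Since \<open>wlap f\<close> is real,
  its two Wirtinger derivatives are conjugate to each other, so two unknown functions
  suffice.\<close>

lemma wirtinger2_wgrad:
  assumes f: "smooth_on f U" and U: "open U"
  obtains f111 f112 where
    "wirtinger2 U (wgrad f) (whess f) (wlap f) f111 f112 (\<lambda>z. cnj (f112 z))"
proof -
  obtain h1 h2 h11 h12 h22 where h: "wirtinger2 U (wgrad f) h1 h2 h11 h12 h22"
    using twice_wirtinger_wgrad_whess_wlap(1)[OF f U] unfolding twice_wirtinger_def by blast
  have *: "h1 z = whess f z" "h2 z = wlap f z" if "z \<in> U" for z
    using wirtinger2_imp_eq(1,2)[OF h that] has_wirtinger_imp_eq[OF has_wirtinger_wgrad[OF f U that]]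
    by simp_all
  have w: "wirtinger2 U (wgrad f) (whess f) (wlap f) h11 h12 h22"
    by (rule wirtinger2_cong[OF h]) (simp_all add: *)
  have "h22 z = cnj (h12 z)" if "z \<in> U" for z
  proof -
    have *: "has_wirtinger (wlap f) (h12 z) (h22 z) z"
      using w that by (simp add: wirtinger2_def)
    have "(\<lambda>w. cnj (wlap f w)) = wlap f" by (simp add: wlap_def fun_eq_iff)
    with has_wirtinger_cnj[OF *] have "has_wirtinger (wlap f) (cnj (h22 z)) (cnj (h12 z)) z"
      by simp
    then show ?thesis
      using has_wirtinger_imp_eq(2)[OF *] has_wirtinger_imp_eq(2) by simp
  qed
  then have "wirtinger2 U (wgrad f) (whess f) (wlap f) h11 h12 (\<lambda>z. cnj (h12 z))"
    by (intro wirtinger2_cong[OF w]) auto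
  then show thesis by (rule that)
qed

text \<open>The coefficients are differentiated when the operator is applied to its own carre du
  champ.\<close>

lemma wirtinger2_gamma_coefficients:
  assumes "open U"
  shows "wirtinger2 U (\<lambda>z. cnj z - z\<^sup>2) (\<lambda>z. - 2 * z) (\<lambda>_. 1) (\<lambda>_. - 2) (\<lambda>_. 0) (\<lambda>_. 0)"
    and "wirtinger2 U (\<lambda>z. 1 - z * cnj z) (\<lambda>z. - cnj z) (\<lambda>z. - z) (\<lambda>_. 0) (\<lambda>_. - 1) (\<lambda>_. 0)"
    and "wirtinger2 U (\<lambda>z. z - (cnj z)\<^sup>2) (\<lambda>_. 1) (\<lambda>z. - 2 * cnj z) (\<lambda>_. 0) (\<lambda>_. 0) (\<lambda>_. - 2)"
proof -
  note i = wirtinger2_ident[OF assms] and c = wirtinger2_cnj[OF wirtinger2_ident[OF assms]]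
    and k = wirtinger2_const[OF assms]
  show 1: "wirtinger2 U (\<lambda>z. cnj z - z\<^sup>2) (\<lambda>z. - 2 * z) (\<lambda>_. 1) (\<lambda>_. - 2) (\<lambda>_. 0) (\<lambda>_. 0)"
    using wirtinger2_add[OF c wirtinger2_mult[OF k[of "-1"] wirtinger2_mult[OF i i]]]
    by (rule wirtinger2_cong) (auto simp: power2_eq_square)
  show "wirtinger2 U (\<lambda>z. 1 - z * cnj z) (\<lambda>z. - cnj z) (\<lambda>z. - z) (\<lambda>_. 0) (\<lambda>_. - 1) (\<lambda>_. 0)"
    using wirtinger2_add[OF k[of 1] wirtinger2_mult[OF k[of "-1"] wirtinger2_mult[OF i c]]]
    by (rule wirtinger2_cong) auto
  show "wirtinger2 U (\<lambda>z. z - (cnj z)\<^sup>2) (\<lambda>_. 1) (\<lambda>z. - 2 * cnj z) (\<lambda>_. 0) (\<lambda>_. 0) (\<lambda>_. - 2)"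
    using wirtinger2_cnj[OF 1] by (rule wirtinger2_cong) auto
qed

text \<open>\<open>H11\<close>, \<open>H12\<close> and \<open>H22\<close> are four times the contravariant components of the Hessian of \<open>f\<close> in the
  flat metric, and \<open>K\<^sup>2 - 4 A B\<close> is four times the negative determinant of the cometric: the first claim
  is \<open>\<bar>H\<bar>\<^sup>2 = (tr H)\<^sup>2 - 2 det H\<close> for the (1,1)-tensor \<open>H\<close>, cleared of denominators, plus the contribution of
  the drift.\<close>

lemma Gamma2_deltoid:
  assumes f: "smooth_on f U" and U: "open U" and z: "z \<in> U"
  defines "F \<equiv> \<lambda>w. complex_of_real (f w)"
  defines "c \<equiv> cnj z" and "p \<equiv> wgrad f z" and "q \<equiv> cnj (wgrad f z)"
    and "p1 \<equiv> whess f z" and "p2 \<equiv> wlap f z" and "q2 \<equiv> cnj (whess f z)"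
  defines "A \<equiv> c - z\<^sup>2" and "K \<equiv> 1 - z * c" and "B \<equiv> z - c\<^sup>2"
  defines "H11 \<equiv> 4 * A\<^sup>2 * p1 + 4 * A * K * p2 + K\<^sup>2 * q2 + (K - 4 * z * A) * p - z * K * q"
    and "H12 \<equiv> 2 * A * K * p1 + (4 * A * B + K\<^sup>2) * p2 + 2 * B * K * q2 - 2 * c * A * p - 2 * z * B * q"
    and "H22 \<equiv> 4 * B\<^sup>2 * q2 + 4 * B * K * p2 + K\<^sup>2 * p1 + (K - 4 * c * B) * q - c * K * p"
  defines "t \<equiv> A * p1 + K * p2 + B * q2 - (z * p + c * q)"
  shows "(K\<^sup>2 - 4 * A * B) * (2 * Gamma2 (deltoid_operator lam) F z
       - (of_real lam - 1) * (c * p\<^sup>2 + 2 * p * q + z * q\<^sup>2))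
     = 2 * (K\<^sup>2 - 4 * A * B) * t\<^sup>2 + (H11 * H22 - H12\<^sup>2)" (is ?Gamma2)
    and "carre_du_champ (deltoid_operator lam) F F z = A * p\<^sup>2 + K * p * q + B * q\<^sup>2" (is ?Gamma)
    and "deltoid_operator lam F z = t - (of_real lam - 1) * (z * p + c * q)" (is ?Op)
    and "(K\<^sup>2 - 4 * A * B) * t = K * H12 - B * H11 - A * H22" (is ?trace)
proof -
  let ?L = "deltoid_operator lam"
  define f1 f2 f11 f12 f22 where fdefs: "f1 = wgrad f" "f2 = (\<lambda>w. cnj (wgrad f w))"
    "f11 = whess f" "f12 = wlap f" "f22 = (\<lambda>w. cnj (whess f w))"
  have w0: "wirtinger2 U F f1 f2 f11 f12 f22"
    unfolding F_def fdefs by (rule wirtinger2_of_real[OF f U])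
  have cnj_f12: "cnj (wlap f w) = wlap f w" for w by (simp add: wlap_def)
  obtain f111 f112 where w1': "wirtinger2 U (wgrad f) (whess f) (wlap f) f111 f112 (\<lambda>z. cnj (f112 z))"
    using wirtinger2_wgrad[OF f U] by blast
  define f122 f222 where f3defs: "f122 = (\<lambda>w. cnj (f112 w))" "f222 = (\<lambda>w. cnj (f111 w))"
  have w1: "wirtinger2 U f1 f11 f12 f111 f112 f122"
    using w1' by (simp add: fdefs f3defs)
  have w2: "wirtinger2 U f2 f12 f22 f112 f122 f222"
    using wirtinger2_cnj[OF w1'] by (simp add: fdefs f3defs cnj_f12)
  note a = wirtinger2_gamma_coefficients[OF U]
  have carre: "\<forall>w\<in>U. (cnj w - w\<^sup>2) * (f1 w * f1 w) + (1 - w * cnj w) * (f1 w * f2 w)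
     + (w - (cnj w)\<^sup>2) * (f2 w * f2 w) = carre_du_champ ?L F F w"
    by (intro ballI, subst carre_du_champ_deltoid_operator[OF w0 w0]) (simp_all add: field_simps)
  \<comment> \<open>The product rule produces all derivatives of the carre du champ by unification,
    so that none has to be written out.\<close>
  note wG = wirtinger2_add[OF
    wirtinger2_add[OF wirtinger2_mult[OF a(1) wirtinger2_mult[OF w1 w1]]
      wirtinger2_mult[OF a(2) wirtinger2_mult[OF w1 w2]]]
    wirtinger2_mult[OF a(3) wirtinger2_mult[OF w2 w2]]]
  note LG = deltoid_operator_wirtinger2[OF wirtinger2_transform[OF wG carre] z, of lam]
  define M where "M = (\<lambda>w. (cnj w - w\<^sup>2) * f11 w + (1 - w * cnj w) * f12 w
    + (w - (cnj w)\<^sup>2) * f22 w + (- of_real lam) * (w * f1 w + cnj w * f2 w))"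
  \<comment> \<open>The carre du champ of \<open>F\<close> and \<open>?L F\<close> is defined
    through second derivatives of \<open>?L F\<close>, which cancel. Hence their existence is
    enough, and only \<open>h1\<close> and \<open>h2\<close> are computed below.\<close>
  have "twice_wirtinger U M"
    unfolding M_def power2_eq_square fdefs
    by (intro twice_wirtinger_intros twice_wirtinger_diff twice_wirtinger_wgrad_whess_wlap[OF f U] U)
  then obtain h1 h2 h11 h12 h22 where wM: "wirtinger2 U M h1 h2 h11 h12 h22"
    unfolding twice_wirtinger_def by blast
  have "\<forall>w\<in>U. M w = ?L F w"
    using deltoid_operator_wirtinger2[OF w0] by (simp add: M_def)
  with wM have wL: "wirtinger2 U (?L F) h1 h2 h11 h12 h22"
    by (rule wirtinger2_transform)
  have *: "has_wirtinger (\<lambda>w. cnj w - w\<^sup>2) (- 2 * z) 1 z"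
    "has_wirtinger (\<lambda>w. 1 - w * cnj w) (- cnj z) (- z) z"
    "has_wirtinger (\<lambda>w. w - (cnj w)\<^sup>2) 1 (- 2 * cnj z) z"
    "has_wirtinger f1 (f11 z) (f12 z) z" "has_wirtinger f2 (f12 z) (f22 z) z"
    "has_wirtinger f11 (f111 z) (f112 z) z" "has_wirtinger f12 (f112 z) (f122 z) z"
    "has_wirtinger f22 (f122 z) (f222 z) z"
    using w1 w2 a z by (auto simp: wirtinger2_def)
  \<comment> \<open>A second computation of the derivative of \<open>M\<close>, now explicit;
    uniqueness then determines \<open>h1 z\<close> and \<open>h2 z\<close>.\<close>
  note D = has_wirtinger_add[OF
    has_wirtinger_add[OF
      has_wirtinger_add[OF has_wirtinger_mult[OF *(1,6)] has_wirtinger_mult[OF *(2,7)]]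
      has_wirtinger_mult[OF *(3,8)]]
    has_wirtinger_mult[OF has_wirtinger_const[of "- of_real lam"]
      has_wirtinger_add[OF has_wirtinger_mult[OF has_wirtinger_ident *(4)]
        has_wirtinger_mult[OF has_wirtinger_cnj[OF has_wirtinger_ident] *(5)]]]]
  have hM: "has_wirtinger M (h1 z) (h2 z) z" using wM z by (simp add: wirtinger2_def)
  define v1 v2 v3 v4 where v_defs: "v1 = f111 z" "v2 = f112 z" "v3 = f122 z" "v4 = f222 z"
  have at_z: "f1 z = p" "f2 z = q" "f11 z = p1" "f12 z = p2" "f22 z = q2"
    by (simp_all add: fdefs p_def q_def p1_def p2_def q2_def)
  have h: "h1 z = - 2 * z * p1 + A * v1 - c * p2 + K * v2 + q2 + B * v3
      - of_real lam * (p + z * p1 + c * p2)"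
    "h2 z = p1 + A * v2 - z * p2 + K * v3 - 2 * c * q2 + B * v4
      - of_real lam * (q + z * p2 + c * q2)"
    using has_wirtinger_imp_eq[OF D] has_wirtinger_imp_eq[OF hM[unfolded M_def]]
    by (simp_all add: v_defs at_z A_def K_def B_def c_def algebra_simps)
  have two_Gamma2: "2 * Gamma2 ?L F z = ?L (carre_du_champ ?L F F) z
      - (2 * A * p * h1 z + K * (p * h2 z + q * h1 z) + 2 * B * q * h2 z)"
    unfolding Gamma2_def carre_du_champ_deltoid_operator[OF w0 wL z] at_z
    by (simp add: A_def B_def K_def c_def field_simps)
  \<comment> \<open>The third derivatives \<open>v1\<close> to \<open>v4\<close> cancel, and what
    remains is a polynomial identity.\<close>
  show ?Gamma2
    unfolding two_Gamma2 LG h at_z v_defs[symmetric] c_def[symmetric]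
    unfolding t_def H11_def H12_def H22_def K_def A_def B_def
    by algebra
  show ?Gamma
    unfolding carre_du_champ_deltoid_operator[OF w0 w0 z] at_z c_def[symmetric]
    by (simp add: K_def A_def B_def field_simps power2_eq_square)
  show ?Op
    unfolding deltoid_operator_wirtinger2[OF w0 z] at_z c_def[symmetric]
    unfolding K_def A_def B_def t_def by algebra
  show ?trace
    unfolding t_def H11_def H12_def H22_def K_def A_def B_def
    by algebra
qed

section \<open>The curvature-dimension inequality\<close>

text \<open>\<open>deltoid_poly\<close> decreases along rays and is at most 0 on the unit circle.
  The strict bound fixes the sign of \<open>1 - (cmod z)\<^sup>2\<close>, which enters
  \<open>deltoid_poly\<close> only through its square.\<close>

lemma deltoid_domain_cmod_less_1: "z \<in> deltoid_domain \<Longrightarrow> cmod z < 1"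
proof (rule ccontr)
  assume "z \<in> deltoid_domain" "\<not> cmod z < 1"
  then have z: "deltoid_poly z > 0" "cmod z \<ge> 1" by (auto simp: deltoid_domain_eq)
  define w where "w = of_real (1 / cmod z) * z"
  have "cmod w = 1" using z(2) by (auto simp: w_def norm_mult norm_divide)
  then have w: "deltoid_poly w \<le> 0" by (simp add: deltoid_poly_def)
  have "deltoid_poly z \<le> deltoid_poly w"
    using deltoid_poly_radial[of "1 / cmod z" z] z by (cases "z = 0"; cases "cmod z = 1") (auto simp: w_def)
  with w z show False by simp
qed

text \<open>With \<open>h\<close> and \<open>k\<close> in the roles of \<open>H12\<close> and
  \<open>H11\<close>, this is the Cauchy-Schwarz bound (tr H)^2 <= 2 |H|^2 in dimension two. As
  |H|^2 = (tr H)^2 - 2 det H, it says that the characteristic polynomial of H has nonnegative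
  discriminant; \<open>D\<close> clears the denominator.\<close>

lemma trace_hessian_estimate:
  fixes A k :: complex and K h t :: real
  defines "D \<equiv> K\<^sup>2 - 4 * (cmod A)\<^sup>2"
  assumes D: "D > 0" and t: "D * t = K * h - 2 * Re (cnj A * k)"
  shows "0 \<le> D * t\<^sup>2 + ((cmod k)\<^sup>2 - h\<^sup>2)"
proof -
  define a m r s where "a = (cmod A)\<^sup>2" and "m = (cmod k)\<^sup>2"
    and "r = Re (cnj A * k)" and "s = Im (cnj A * k)"
  have rs: "r\<^sup>2 + s\<^sup>2 = a * m"
    unfolding r_def s_def cmod_power2[symmetric] by (simp add: norm_mult power_mult_distrib a_def m_def)
  define Q where "Q = (D * t)\<^sup>2 + D * (m - h\<^sup>2)"
  have "0 \<le> Q"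
  proof (cases "a = 0")
    case True
    then have "r = 0" "D = K\<^sup>2" using rs by (auto simp: D_def a_def)
    then have "Q = K\<^sup>2 * m"
      using t by (simp add: Q_def r_def power_mult_distrib algebra_simps)
    then show ?thesis by (simp add: m_def)
  next
    case False
    then have "a > 0" by (simp add: a_def)
    \<comment> \<open>The factor \<open>a\<close> turns \<open>m\<close> into \<open>a * m\<close>,
      which is \<open>r\<^sup>2 + s\<^sup>2\<close>; this makes the sum of squares visible and is
      why \<open>a = 0\<close> is treated apart.\<close>
    have "a * Q = (2 * a * h - K * r)\<^sup>2 + D * s\<^sup>2"
      using rs unfolding Q_def t unfolding D_def a_def[symmetric] r_def[symmetric] by algebra
    then have "0 \<le> a * Q" using D by simp
    then show ?thesis using \<open>a > 0\<close> by (simp add: zero_le_mult_iff)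
  qed
  also have "Q = D * (D * t\<^sup>2 + (m - h\<^sup>2))"
    by (simp add: Q_def power2_eq_square algebra_simps)
  finally show ?thesis
    using D by (simp add: zero_le_mult_iff m_def)
qed

theorem corollary4p3:
  fixes lam :: real
  assumes "lam \<ge> 1"
  shows "curvature_dimension deltoid_domain (deltoid_operator lam) (3 * (lam - 1) / 4) (ereal (2 * lam))"
  unfolding curvature_dimension_def Let_def
proof (intro conjI ballI)
  show "1 \<le> ereal (2 * lam)" using assms by (simp add: one_ereal_def)
  fix f z assume f: "f \<in> smooth_near_closure deltoid_domain" and z: "z \<in> deltoid_domain"
  obtain U where U: "open U" "closure deltoid_domain \<subseteq> U" "smooth_on f U"
    using f by (auto simp: smooth_near_closure_def)
  have zU: "z \<in> U" using U(2) z closure_subset by blast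
  let ?F = "\<lambda>w. complex_of_real (f w)" and ?L = "deltoid_operator lam"
  define p p1 p2 where "p = wgrad f z" and "p1 = whess f z" and "p2 = wlap f z"
  define A K where "A = cnj z - z\<^sup>2" and "K = 1 - (cmod z)\<^sup>2"
  define B k where "B = z - (cnj z)\<^sup>2" and "k = complex_of_real K"
  have norm_sq: "(of_real (cmod w))\<^sup>2 = w * cnj w" for w
    using complex_norm_square[of w] by simp
  have KB: "1 - z * cnj z = k" "cnj A = B"
    by (simp_all add: A_def B_def K_def k_def norm_sq)
  have p2: "cnj p2 = p2" by (simp add: p2_def wlap_def)
  define H11 H12 H22 t E where
    "H11 = 4 * A\<^sup>2 * p1 + 4 * A * k * p2 + k\<^sup>2 * cnj p1 + (k - 4 * z * A) * p - z * k * cnj p"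
    and "H12 = 2 * A * k * p1 + (4 * A * B + k\<^sup>2) * p2 + 2 * B * k * cnj p1
      - 2 * cnj z * A * p - 2 * z * B * cnj p"
    and "H22 = 4 * B\<^sup>2 * cnj p1 + 4 * B * k * p2 + k\<^sup>2 * p1
      + (k - 4 * cnj z * B) * cnj p - cnj z * k * p"
    and "t = A * p1 + k * p2 + B * cnj p1 - (z * p + cnj z * cnj p)"
    and "E = z * p + cnj z * cnj p"
  define R where "R = (cnj z * p\<^sup>2 + 2 * p * cnj p + z * (cnj p)\<^sup>2) / 2"
  \<comment> \<open>\<open>R\<close> is the contribution of the drift per unit of
    \<open>lam - 1\<close>; what is left is the \<open>Gamma2\<close> of the flat Laplacian.\<close>
  define T where "T = Gamma2 ?L ?F z - (of_real lam - 1) * R"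
  have two_T: "2 * T = 2 * Gamma2 ?L ?F z
      - (of_real lam - 1) * (cnj z * p\<^sup>2 + 2 * p * cnj p + z * (cnj p)\<^sup>2)"
    by (simp add: T_def R_def field_simps)
  have Gamma2: "2 * (k\<^sup>2 - 4 * A * B) * T = 2 * (k\<^sup>2 - 4 * A * B) * t\<^sup>2 + (H11 * H22 - H12\<^sup>2)"
    and Gamma: "carre_du_champ ?L ?F ?F z = A * p\<^sup>2 + k * p * cnj p + B * (cnj p)\<^sup>2"
    and Op: "?L ?F z = t - (of_real lam - 1) * E"
    and trace: "(k\<^sup>2 - 4 * A * B) * t = k * H12 - B * H11 - A * H22"
    using Gamma2_deltoid(1-3)[OF U(3,1) zU, of lam] Gamma2_deltoid(4)[OF U(3,1) zU]
    unfolding mult.assoc[of 2 "k\<^sup>2 - 4 * A * B" T] mult.left_commute[of 2 _ T] two_T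
      KB(1) A_def[symmetric] B_def[symmetric] p_def[symmetric] p1_def[symmetric] p2_def[symmetric]
      H11_def[symmetric] H12_def[symmetric] H22_def[symmetric] t_def[symmetric]
    unfolding E_def[symmetric]
    by simp_all
  \<comment> \<open>Invariance under conjugation turns \<open>H12\<close>, \<open>t\<close> and
    \<open>E\<close> into real numbers and \<open>H11 * H22\<close> into a squared modulus, so the
    estimates can be made over the reals.\<close>
  have "cnj B = A" using KB by auto
  have real: "cnj H12 = H12" "cnj t = t" "cnj E = E" and H22: "cnj H11 = H22"
    using p2 KB(2) \<open>cnj B = A\<close> by (simp_all add: H12_def H11_def H22_def t_def E_def k_def algebra_simps)
  obtain h t' e where hte: "H12 = of_real h" "t = of_real t'" "E = of_real e"
    using real by (metis Reals_cnj_iff Reals_cases)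
  define D where "D = K\<^sup>2 - 4 * (cmod A)\<^sup>2"
  have D: "of_real D = k\<^sup>2 - 4 * A * B"
    by (simp add: D_def k_def norm_sq KB(2) mult.assoc)
  have "D = deltoid_poly z" by (simp add: D_def deltoid_poly_def K_def A_def)
  then have D0: "D > 0" using z by (simp add: deltoid_domain_eq)
  \<comment> \<open>Positivity of \<open>D\<close> only compares squares; the sign of
    \<open>K\<close> is needed to deduce the ellipticity bound
    \<open>2 * cmod A < K\<close>.\<close>
  have K0: "K > 0" using deltoid_domain_cmod_less_1[OF z] by (simp add: K_def power_less_one_iff abs_square_less_1)
  have "(2 * cmod A)\<^sup>2 < K\<^sup>2" using D0 by (simp add: D_def)
  then have A_less: "2 * cmod A < K" by (rule power_less_imp_less_base) (use K0 in simp)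

  define T' where "T' = t'\<^sup>2 + ((cmod H11)\<^sup>2 - h\<^sup>2) / (2 * D)"
  have T: "T = of_real T'"
  proof -
    have "2 * of_real D * T = 2 * of_real D * t\<^sup>2 + (of_real ((cmod H11)\<^sup>2) - (of_real h)\<^sup>2)"
      using Gamma2 H22 by (simp add: D hte norm_sq)
    then show ?thesis using D0 by (simp add: T'_def hte field_simps)
  qed
  have "of_real (D * t') = complex_of_real (K * h - 2 * Re (B * H11))"
  proof -
    have "B * H11 + A * H22 = of_real (2 * Re (B * H11))"
      using complex_add_cnj[of "B * H11"] \<open>cnj B = A\<close> H22 by simp
    then show ?thesis using trace by (simp add: hte k_def D[symmetric, unfolded k_def] diff_diff_eq)
  qed
  then have "D * t' = K * h - 2 * Re (cnj A * H11)"
    unfolding KB(2) by (simp only: of_real_eq_iff)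
  then have "0 \<le> D * t'\<^sup>2 + ((cmod H11)\<^sup>2 - h\<^sup>2)"
    using trace_hessian_estimate[of K A t' h H11] D0 by (simp add: D_def)
  then have T_ge: "t'\<^sup>2 / 2 \<le> T'"
    using D0 by (simp add: T'_def field_simps)

  define S where "S = (K * (cmod p)\<^sup>2 - 2 * Re (A * p\<^sup>2)) / 4"
  have "2 * Re (A * p\<^sup>2) \<le> 2 * cmod A * (cmod p)\<^sup>2"
    using complex_Re_le_cmod[of "A * p\<^sup>2"] by (simp add: norm_mult norm_power)
  also have "\<dots> \<le> K * (cmod p)\<^sup>2" using A_less by (intro mult_right_mono) auto
  finally have S_ge: "0 \<le> S" by (simp add: S_def)
  have S: "of_real S = (k * p * cnj p - A * p\<^sup>2 - B * (cnj p)\<^sup>2) / 4"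
  proof -
    have "A * p\<^sup>2 + B * (cnj p)\<^sup>2 = of_real (2 * Re (A * p\<^sup>2))"
      using complex_add_cnj[of "A * p\<^sup>2"] KB(2) by simp
    moreover have "of_real (K * (cmod p)\<^sup>2) = k * p * cnj p" by (simp add: k_def norm_sq)
    ultimately show ?thesis by (simp add: S_def diff_diff_eq del: of_real_mult)
  qed

  define \<mu> where "\<mu> = lam - 1"
  have \<mu>: "\<mu> \<ge> 0" "lam = \<mu> + 1" "\<mu> + 1 \<noteq> 0" using assms by (auto simp: \<mu>_def)
  \<comment> \<open>The curvature constant arises here: 3/4 is the largest multiple of the carre du
    champ that can be split off while \<open>2 * cmod A \<le> K\<close> alone still keeps the
    remainder nonnegative.\<close>
  have R: "R = of_real S + 3 / 4 * carre_du_champ ?L ?F ?F z + E\<^sup>2 / 2"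
  proof -
    have "2 * (cnj z * p\<^sup>2 + 2 * p * cnj p + z * (cnj p)\<^sup>2) = (k * p * cnj p - A * p\<^sup>2 - B * (cnj p)\<^sup>2)
        + 3 * (A * p\<^sup>2 + k * p * cnj p + B * (cnj p)\<^sup>2) + 2 * E\<^sup>2"
      unfolding E_def KB(1)[symmetric] A_def B_def by algebra
    moreover have "x / 2 = y / 4 + 3 / 4 * w + v / 2" if "2 * x = y + 3 * w + 2 * v" for x y w v :: complex
    proof -
      have "x = (y + 3 * w + 2 * v) / 2" using that[symmetric] by simp
      then show ?thesis by (simp add: add_divide_distrib)
    qed
    ultimately show ?thesis unfolding S Gamma R_def by blast
  qed
  \<comment> \<open>The dimension \<open>2 * lam\<close> arises here: \<open>u\<close> is the term
    \<open>(L f)\<^sup>2 / (2 * lam)\<close>, and \<open>v\<close> is the defect in the weighted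
    Cauchy-Schwarz inequality \<open>(t' - \<mu> * e)\<^sup>2 \<le> (1 + \<mu>) * (t'\<^sup>2 +
    \<mu> * e\<^sup>2)\<close>, divided by \<open>2 * lam\<close>.\<close>
  define u v where "u = 1 / (2 * lam) * (t' - \<mu> * e)\<^sup>2" and "v = \<mu> * (t' + e)\<^sup>2 / (2 * lam)"
  define Q where "Q = (T' - t'\<^sup>2 / 2) + v + \<mu> * S"
  have Q: "0 \<le> Q" unfolding Q_def v_def using T_ge S_ge \<mu> by (intro add_nonneg_nonneg) auto
  have "u + v = ((t' - \<mu> * e)\<^sup>2 + \<mu> * (t' + e)\<^sup>2) / (2 * lam)"
    by (simp add: u_def v_def add_divide_distrib)
  also have "(t' - \<mu> * e)\<^sup>2 + \<mu> * (t' + e)\<^sup>2 = (t'\<^sup>2 + \<mu> * e\<^sup>2) * lam"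
    unfolding \<mu>(2) by algebra
  also have "\<dots> / (2 * lam) = t'\<^sup>2 / 2 + \<mu> * e\<^sup>2 / 2"
    using assms by (simp add: add_divide_distrib)
  finally have uv: "u = t'\<^sup>2 / 2 + \<mu> * e\<^sup>2 / 2 - v"
    by simp
  have "Gamma2 ?L ?F z = T + of_real \<mu> * R" by (simp add: T_def \<mu>_def)
  also have "\<dots> = of_real (3 * \<mu> / 4) * carre_du_champ ?L ?F ?F z + of_real u + of_real Q"
    unfolding R T hte uv Q_def by (simp add: algebra_simps)
  also have "complex_of_real u = of_real (1 / (2 * lam)) * (?L ?F z)\<^sup>2"
    by (simp add: Op hte u_def \<mu>_def)
  finally have "Gamma2 ?L ?F z = of_real (3 * (lam - 1) / 4) * carre_du_champ ?L ?F ?F z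
      + of_real (1 / (2 * lam)) * (?L ?F z)\<^sup>2 + of_real Q"
    by (simp add: \<mu>_def)
  moreover have "real_of_ereal (1 / ereal (2 * lam)) = 1 / (2 * lam)"
    using assms by (simp add: one_ereal_def)
  moreover have "0 \<le> complex_of_real Q" using Q by (simp add: less_eq_complex_def)
  ultimately show "of_real (3 * (lam - 1) / 4) * carre_du_champ ?L ?F ?F z
      + of_real (real_of_ereal (1 / ereal (2 * lam))) * (?L ?F z)\<^sup>2 \<le> Gamma2 ?L ?F z"
    by (simp add: less_eq_complex_def)
qed

end
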